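(* Let $\alpha\ge 0$ and $\beta\ge 0$ be real numbers, and let $f\in\mathcal{A}$ satisfy $f(z)f'(z)/z\neq 0$ for all $z\in\mathbb{D}$. If at least one of the following inequalities holds for all $z\in\mathbb{D}$: (i) $\operatorname{Re}\big(Q_{CV}(\alpha Q_{ST}+(1-\alpha)Q_{ST}^2+\beta Q_{SD})\big)>-\alpha/2$; (ii) $\operatorname{Re}\big(Q_{ST}(\alpha Q_{CV}+(1-\alpha)Q_{CV}^2+\beta Q_{SD})\big)>-\alpha/2$; (iii) $\operatorname{Re}\big(Q_{ST}(\alpha Q_{CV}+(1-\alpha)Q_{ST}^2+\beta Q_{SD})\big)>-\alpha/2$; (iv) $\operatorname{Re}\big(Q_{CV}(\alpha Q_{ST}+(1-\alpha)Q_{CV}^2+\beta Q_{SD})\big)>-\alpha/2$; then $f$ is starlike.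
   Context: $\mathbb{D}=\{z\in\mathbb{C}:|z|<1\}$. $\mathcal{A}$ is the class of analytic functions $f:\mathbb{D}\to\mathbb{C}$ with $f(0)=0$ and $f'(0)=1$. For $f\in\mathcal{A}$, as functions of $z\in\mathbb{D}$: $Q_{ST}=zf'(z)/f(z)$ (with the removable singularity at $z=0$ filled in, value $1$), $Q_{CV}=1+zf''(z)/f'(z)$, and $Q_{SD}=z^2\Big(\big(f''(z)/f'(z)\big)'-\tfrac12\big(f''(z)/f'(z)\big)^2\Big)$ ($z^2$ times the Schwarzian derivative of $f$). The condition $f(z)f'(z)/z\neq0$ is understood at $z=0$ via the removable singularity (where the value is $1$). A function $f\in\mathcal{A}$ is starlike if $\operatorname{Re}Q_{ST}>0$ on $\mathbb{D}$; equivalently, $f$ is univalent and $tf(z)\in f(\mathbb{D})$ for all $z\in\mathbb{D}$, $t\in[0,1]$. *)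

theory Defs
  imports "HOL-Complex_Analysis.Complex_Analysis"
begin

abbreviation unit_disc :: "complex set" where
  "unit_disc \<equiv> ball 0 1"

(* Functions on the disc are total functions complex => complex; all notions below
   depend only on their values on the (open) unit disc. *)
definition class_A :: "(complex \<Rightarrow> complex) set" where
  "class_A = {f. f holomorphic_on unit_disc \<and> f 0 = 0 \<and> deriv f 0 = 1}"

(* The singularity at 0 is removable with value 1, see Q_ST_tendsto below.
   At a zero of f other than 0 the value is 0, by the convention x / 0 = 0. *)
definition Q_ST :: "(complex \<Rightarrow> complex) \<Rightarrow> complex \<Rightarrow> complex" where
  "Q_ST f z = (if z = 0 then 1 else z * deriv f z / f z)"

definition Q_CV :: "(complex \<Rightarrow> complex) \<Rightarrow> complex \<Rightarrow> complex" where
  "Q_CV f z = 1 + z * deriv (deriv f) z / deriv f z"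

definition schwarzian :: "(complex \<Rightarrow> complex) \<Rightarrow> complex \<Rightarrow> complex" where
  "schwarzian f z =
     deriv (\<lambda>w. deriv (deriv f) w / deriv f w) z - 1 / 2 * (deriv (deriv f) z / deriv f z)\<^sup>2"

definition Q_SD :: "(complex \<Rightarrow> complex) \<Rightarrow> complex \<Rightarrow> complex" where
  "Q_SD f z = z\<^sup>2 * schwarzian f z"

(* f(z) f'(z) / z with the removable singularity at 0 filled in, see
   ff'_over_z_tendsto below. *)
definition ff'_over_z :: "(complex \<Rightarrow> complex) \<Rightarrow> complex \<Rightarrow> complex" where
  "ff'_over_z f z = (if z = 0 then 1 else f z * deriv f z / z)"

(* Starlikeness of a function with respect to the origin; not to be confused with the
   predicate starlike on sets. *)
definition starlike_function :: "(complex \<Rightarrow> complex) \<Rightarrow> bool" where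
  "starlike_function f \<longleftrightarrow> f \<in> class_A \<and> (\<forall>z\<in>unit_disc. Re (Q_ST f z) > 0)"

lemma class_A_tendsto:
  assumes "f \<in> class_A"
  shows "((\<lambda>z. f z / z) \<longlongrightarrow> 1) (at 0)" and "(deriv f \<longlongrightarrow> 1) (at 0)"
proof -
  have hol: "f holomorphic_on unit_disc" and f: "f 0 = 0" "deriv f 0 = 1"
    using assms by (auto simp: class_A_def)
  have "(f has_field_derivative 1) (at 0)"
    using holomorphic_derivI[OF hol, of 0] f by simp
  then show "((\<lambda>z. f z / z) \<longlongrightarrow> 1) (at 0)"
    by (simp add: has_field_derivative_iff f)
  have "deriv f holomorphic_on unit_disc"
    using hol by (intro holomorphic_deriv) auto
  then have "isCont (deriv f) 0"
    by (intro continuous_on_interior[OF holomorphic_on_imp_continuous_on]) auto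
  then show "(deriv f \<longlongrightarrow> 1) (at 0)"
    by (simp add: isCont_def f)
qed

lemma Q_ST_tendsto:
  assumes "f \<in> class_A"
  shows "((\<lambda>z. z * deriv f z / f z) \<longlongrightarrow> 1) (at 0)"
  using tendsto_divide[OF class_A_tendsto(2,1)[OF assms]] by (simp add: mult.commute)

lemma ff'_over_z_tendsto:
  assumes "f \<in> class_A"
  shows "((\<lambda>z. f z * deriv f z / z) \<longlongrightarrow> 1) (at 0)"
  using tendsto_mult[OF class_A_tendsto[OF assms]] by simp

end

theory Submission
  imports Defs
begin

text \<open>
  Write \<open>p = z f' / f\<close>, a zero-free analytic function with \<open>p 0 = 1\<close>. If \<open>f\<close> is not starlike, then
  \<open>Re p\<close> vanishes somewhere, and at a zero \<open>z\<close> of \<open>Re p\<close> of least modulus (\<open>first_zero_of_real_part\<close>) the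
  function \<open>Re p\<close> attains its minimum over the closed disc of radius \<open>\<bar>z\<bar>\<close>. Three facts follow, in
  the spirit of the Miller--Mocanu lemma. The first two conditions for a minimum along the circle
  make \<open>s = z p'(z)\<close> real with \<open>s + Re m \<le> 0\<close> for \<open>m = z\<^sup>2 p''(z)\<close>
  (\<open>tangential_derivatives_at_circle_min\<close>), and Harnack's inequality along the radius gives
  \<open>s \<le> -1/2\<close> (\<open>radial_derivative_at_first_zero\<close>).

  The other two quotients are differential expressions in \<open>p\<close>:
  \<open>Q_CV = p + z p' / p\<close> and \<open>Q_SD = z Q_CV' + (1 - Q_CV\<^sup>2) / 2\<close>. Put \<open>p z = \<i> \<rho>\<close>. Since
  \<open>s\<close> is real, \<open>Q_CV\<close> is also imaginary at \<open>z\<close>, say \<open>\<i> \<tau>\<close>, and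
  \<open>\<rho> \<tau> = \<rho>\<^sup>2 - s \<ge> 1/2\<close>. In \<open>Q_SD\<close> every term is real except \<open>(s + m) / (\<i> \<rho>)\<close>, so
  \<open>\<rho> Im Q_SD = -(s + Re m) \<ge> 0\<close>, and \<open>\<tau>\<close> has the sign of \<open>\<rho>\<close>.

  All four hypotheses concern a product of one of \<open>\<i> \<rho>\<close>, \<open>\<i> \<tau>\<close> with \<open>\<alpha>\<close> times the other one,
  plus a real multiple of a square, plus \<open>\<beta> Q_SD\<close>. The squares are real, so they contribute nothing
  to the real part, which is \<open>-\<alpha> \<rho> \<tau>\<close> minus a nonnegative number, hence at most \<open>-\<alpha>/2\<close>
  (\<open>Re_imaginary_product_le\<close>). This contradicts each of the four hypotheses at \<open>z\<close>.
\<close>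

section \<open>The first zero of the real part of an analytic function\<close>

text \<open>
  If \<open>u''(c) < 0\<close>, then \<open>u'\<close> is negative just to the right of its zero \<open>c\<close>, so that \<open>u\<close> drops
  below its minimum there.
\<close>
lemma second_deriv_nonneg_at_min:
  fixes u u' :: "real \<Rightarrow> real"
  assumes u: "\<And>x. (u has_real_derivative u' x) (at x)"
    and u': "(u' has_real_derivative l) (at c)"
    and min: "\<And>x. u c \<le> u x"
  shows "u' c = 0" and "0 \<le> l"
proof -
  show crit: "u' c = 0"
    using DERIV_local_min[OF u, of 1 c] min by simp
  show "0 \<le> l"
  proof (rule ccontr)
    assume "\<not> 0 \<le> l"
    then obtain d where d: "d > 0" "\<And>h. 0 < h \<Longrightarrow> h < d \<Longrightarrow> u' (c + h) < u' c"
      using DERIV_neg_dec_right[OF u'] by auto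
    have "u (c + d / 2) < u c"
    proof (rule DERIV_neg_imp_decreasing_open[where f = u])
      show "c < c + d / 2" using d by simp
      show "\<exists>y. (u has_real_derivative y) (at x) \<and> y < 0" if "c < x" "x < c + d / 2" for x
        using that u[of x] d(2)[of "x - c"] crit by (intro exI[of _ "u' x"]) auto
      show "continuous_on {c..c + d / 2} u"
        using u by (meson DERIV_isCont continuous_at_imp_continuous_on)
    qed
    then show False using min[of "c + d / 2"] by simp
  qed
qed

lemma norm_one_minus_less_norm_one_plus:
  fixes w :: complex
  assumes "Re w > 0"
  shows "norm (1 - w) < norm (1 + w)"
  using assms by (simp add: cmod_def power2_eq_square algebra_simps)

text \<open>
  The Cayley transform \<open>(1 - p) / (1 + p)\<close> maps the disc into itself and fixes the origin. Schwarz's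
  lemma then gives \<open>\<bar>1 - p\<bar> \<le> \<bar>z\<bar> \<bar>1 + p\<bar>\<close>; discarding imaginary parts can only weaken this.
\<close>
lemma Harnack_lower_bound:
  assumes hol: "p holomorphic_on ball 0 1" and p0: "p 0 = 1"
    and pos: "\<And>z. norm z < 1 \<Longrightarrow> Re (p z) > 0" and z: "norm z < 1"
  shows "1 - norm z \<le> (1 + norm z) * Re (p z)"
proof -
  have nz: "1 + p w \<noteq> 0" if "norm w < 1" for w
  proof
    assume "1 + p w = 0"
    then have "Re (1 + p w) = 0" by simp
    then show False using pos[OF that] by simp
  qed
  have hw: "(\<lambda>w. (1 - p w) / (1 + p w)) holomorphic_on ball 0 1"
    using hol nz by (intro holomorphic_intros) auto
  have "norm ((1 - p z) / (1 + p z)) \<le> norm z"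
  proof (rule Schwarz_Lemma(1)[OF hw])
    show "norm ((1 - p w) / (1 + p w)) < 1" if "norm w < 1" for w
      using norm_one_minus_less_norm_one_plus[OF pos[OF that]] nz[OF that]
      by (simp add: norm_divide divide_simps)
  qed (use p0 z in auto)
  then have "norm (1 - p z) \<le> norm z * norm (1 + p z)"
    using nz[OF z] by (simp add: norm_divide divide_simps)
  then have "(norm (1 - p z))\<^sup>2 \<le> (norm z)\<^sup>2 * (norm (1 + p z))\<^sup>2"
    by (metis norm_ge_zero power_mono power_mult_distrib)
  then have "(1 - Re (p z))\<^sup>2 + (Im (p z))\<^sup>2
      \<le> (norm z)\<^sup>2 * (1 + Re (p z))\<^sup>2 + (norm z)\<^sup>2 * (Im (p z))\<^sup>2"
    unfolding cmod_power2 by (simp add: distrib_left)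
  moreover have "(norm z)\<^sup>2 * (Im (p z))\<^sup>2 \<le> (Im (p z))\<^sup>2"
    using z by (intro mult_left_le_one_le) (auto simp: power_le_one)
  ultimately have "(1 - Re (p z))\<^sup>2 \<le> (norm z * (1 + Re (p z)))\<^sup>2"
    by (simp add: power_mult_distrib)
  then have "1 - Re (p z) \<le> norm z * (1 + Re (p z))"
    by (rule power2_le_imp_le) (use pos[OF z] in auto)
  then show ?thesis by (simp add: algebra_simps)
qed

text \<open>
  The points of a closed disc with \<open>Re p \<le> 0\<close> form a compact set, so one of them is nearest to the
  origin. On the open disc up to that point \<open>Re p\<close> is positive, and continuity settles the boundary.
\<close>
lemma first_zero_of_real_part:
  assumes hol: "p holomorphic_on ball 0 1" and p0: "p 0 = 1"
    and z1: "norm z1 < 1" "Re (p z1) \<le> 0"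
  obtains z where "norm z < 1" "z \<noteq> 0" "Re (p z) = 0"
    "\<And>w. norm w < norm z \<Longrightarrow> Re (p w) > 0" "\<And>w. norm w \<le> norm z \<Longrightarrow> Re (p w) \<ge> 0"
proof -
  have cont: "continuous_on (ball 0 1) (\<lambda>w. Re (p w))"
    using hol by (intro continuous_intros holomorphic_on_imp_continuous_on)
  define K where "K = {w \<in> cball 0 (norm z1). Re (p w) \<le> 0}"
  have "closed K"
    unfolding K_def
    by (intro continuous_on_closed_Collect_le continuous_on_subset[OF cont] continuous_intros)
      (use z1 in auto)
  then have "compact K"
    using compact_Int_closed[of "cball 0 (norm z1)" K] by (simp add: K_def Int_def conj_ac)
  moreover have "z1 \<in> K" using z1 by (auto simp: K_def)
  ultimately obtain z where z: "z \<in> K" "\<And>w. w \<in> K \<Longrightarrow> norm z \<le> norm w"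
    using continuous_attains_inf[of K norm] continuous_on_norm_id by blast
  have nz: "z \<noteq> 0" using z p0 by (auto simp: K_def)
  have z_lt: "norm z < 1" using z(1) z1(1) by (simp add: K_def)
  have pos: "Re (p w) > 0" if "norm w < norm z" for w
  proof -
    have "w \<notin> K" using z(2)[of w] that by (auto simp: not_le)
    moreover have "norm z \<le> norm z1" using z(1) by (simp add: K_def)
    ultimately show ?thesis using that by (simp add: K_def)
  qed
  have nonneg: "Re (p w) \<ge> 0" if "norm w \<le> norm z" for w
  proof -
    have "w \<in> closure (ball 0 (norm z))" using that nz by simp
    moreover have "continuous_on (closure (ball 0 (norm z))) (\<lambda>w. Re (p w))"
      using nz z_lt by (intro continuous_on_subset[OF cont]) auto
    ultimately show ?thesis
      using continuous_ge_on_closure[of "ball 0 (norm z)" "\<lambda>w. Re (p w)" w 0] pos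
      by (force intro: less_imp_le)
  qed
  have "Re (p z) = 0" using nonneg[of z] z(1) by (simp add: K_def)
  then show ?thesis using that z_lt nz pos nonneg by blast
qed

text \<open>
  Along the circle \<open>\<theta> \<mapsto> z exp (\<i> \<theta>)\<close> differentiation in \<open>\<theta>\<close> is the operator \<open>\<i> z d/dz\<close>. At a
  minimum the first derivative \<open>Re (\<i> z p')\<close> is zero and the second, \<open>- Re (z p' + z\<^sup>2 p'')\<close>, is
  nonnegative.
\<close>
lemma tangential_derivatives_at_circle_min:
  assumes hol: "p holomorphic_on ball 0 R" and z: "norm z < R"
    and min: "\<And>w. norm w = norm z \<Longrightarrow> Re (p z) \<le> Re (p w)"
  shows "Im (z * deriv p z) = 0"
    and "Re (z * deriv p z + z\<^sup>2 * deriv (deriv p) z) \<le> 0"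
proof -
  define c where "c \<theta> = z * exp (\<i> * of_real \<theta>)" for \<theta> :: real
  have c_norm: "norm (c \<theta>) = norm z" for \<theta>
    by (simp add: c_def norm_mult)
  have c_der: "(c has_vector_derivative \<i> * c \<theta>) (at \<theta>)" for \<theta>
    unfolding c_def
    by (rule has_vector_derivative_real_field)
      (auto intro!: derivative_eq_intros)
  have hol': "deriv p holomorphic_on ball 0 R"
    using hol by (intro holomorphic_deriv) auto
  have chain: "((\<lambda>\<theta>. g (c \<theta>)) has_vector_derivative \<i> * c \<theta> * deriv g (c \<theta>)) (at \<theta>)"
    if "g holomorphic_on ball 0 R" for g \<theta>
  proof -
    have "(g has_field_derivative deriv g (c \<theta>)) (at (c \<theta>))"
      using that z c_norm by (intro holomorphic_derivI[of _ "ball 0 R"]) auto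
    from field_vector_diff_chain_at[OF c_der this]
    show ?thesis by (simp add: o_def)
  qed
  define u where "u \<theta> = Re (p (c \<theta>))" for \<theta>
  define u' where "u' \<theta> = Re (\<i> * c \<theta> * deriv p (c \<theta>))" for \<theta>
  have u: "(u has_real_derivative u' \<theta>) (at \<theta>)" for \<theta>
    unfolding u_def u'_def
    by (rule has_field_derivative_Re[OF chain[OF hol]])
  have "((\<lambda>\<theta>. \<i> * c \<theta> * deriv p (c \<theta>)) has_vector_derivative
      \<i> * c 0 * (\<i> * c 0 * deriv (deriv p) (c 0)) + \<i> * (\<i> * c 0) * deriv p (c 0)) (at 0)"
    by (intro has_vector_derivative_mult has_vector_derivative_mult_right chain[OF hol'] c_der)
  then have u': "(u' has_real_derivative
      Re (\<i> * c 0 * (\<i> * c 0 * deriv (deriv p) (c 0)) + \<i> * (\<i> * c 0) * deriv p (c 0))) (at 0)"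
    unfolding u'_def
    by (rule has_field_derivative_Re)
  have c0: "c 0 = z" by (simp add: c_def)
  have "u 0 \<le> u \<theta>" for \<theta>
    unfolding u_def c0 by (rule min) (simp add: c_norm)
  from second_deriv_nonneg_at_min[OF u u' this]
  show "Im (z * deriv p z) = 0"
    and "Re (z * deriv p z + z\<^sup>2 * deriv (deriv p) z) \<le> 0"
    by (simp_all add: u'_def c0 power2_eq_square algebra_simps)
qed

text \<open>
  Harnack's inequality for the function rescaled to the unit disc reads
  \<open>(1 + t) Re (p (t z)) - (1 - t) \<ge> 0\<close> for \<open>0 < t < 1\<close>. The left-hand side vanishes at \<open>t = 1\<close>, so
  its derivative \<open>2 Re (z p'(z)) + 1\<close> cannot be positive there.
\<close>
lemma radial_derivative_at_first_zero:
  assumes hol: "p holomorphic_on ball 0 R" and z: "norm z < R" and nz: "z \<noteq> 0" and p0: "p 0 = 1"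
    and pos: "\<And>w. norm w < norm z \<Longrightarrow> Re (p w) > 0" and zero: "Re (p z) = 0"
  shows "Re (z * deriv p z) \<le> - 1 / 2"
proof -
  have small: "norm (z * w) < norm z" if "norm w < 1" for w
    using that nz by (simp add: norm_mult)
  have hol_scaled: "(\<lambda>w. p (z * w)) holomorphic_on ball 0 1"
  proof (rule holomorphic_on_compose_gen[OF _ hol, unfolded o_def])
    show "(\<lambda>w. z * w) ` ball 0 1 \<subseteq> ball 0 R"
      using small z by force
  qed (intro holomorphic_intros)
  have lower: "1 - t \<le> (1 + t) * Re (p (z * of_real t))" if "0 < t" "t < 1" for t :: real
    using Harnack_lower_bound[OF hol_scaled, of "of_real t"] p0 pos[OF small] that by simp
  define v where "v t = Re (p (z * of_real t))" for t :: real
  define g where "g t = (1 + t) * v t - (1 - t)" for t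
  have "((\<lambda>t. p (z * of_real t)) has_vector_derivative z * deriv p z) (at (1::real))"
  proof -
    have "(p has_field_derivative deriv p z) (at z)"
      using z by (intro holomorphic_derivI[OF hol]) auto
    then have "((\<lambda>w. p (z * w)) has_field_derivative deriv p z * z) (at (of_real 1))"
      by (intro DERIV_chain2[where f = p]) (auto intro!: derivative_eq_intros)
    from has_vector_derivative_real_field[OF this] show ?thesis
      by (simp add: mult.commute)
  qed
  then have "(v has_real_derivative Re (z * deriv p z)) (at 1)"
    unfolding v_def by (rule has_field_derivative_Re)
  moreover have "v 1 = 0" using zero by (simp add: v_def)
  ultimately have g': "(g has_real_derivative 2 * Re (z * deriv p z) + 1) (at 1)"
    unfolding g_def by (auto intro!: derivative_eq_intros)
  show ?thesis
  proof (rule ccontr)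
    assume "\<not> ?thesis"
    then have "2 * Re (z * deriv p z) + 1 > 0" by simp
    from DERIV_pos_inc_left[OF g' this] obtain d
      where d: "d > 0" "\<And>h. 0 < h \<Longrightarrow> h < d \<Longrightarrow> g (1 - h) < g 1" by auto
    define h where "h = min (d / 2) (1 / 2)"
    have "g (1 - h) < g 1" using d(1) by (intro d(2)) (auto simp: h_def)
    moreover have "g 1 = 0" using zero by (simp add: g_def v_def)
    moreover have "g (1 - h) \<ge> 0"
      using lower[of "1 - h"] d(1) by (simp add: g_def v_def h_def)
    ultimately show False by simp
  qed
qed

section \<open>The three quotients of a locally univalent function\<close>

lemma class_A_nonvanishing:
  assumes f: "f \<in> class_A" and ff': "\<forall>z\<in>unit_disc. ff'_over_z f z \<noteq> 0" and z: "z \<in> unit_disc"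
  shows "deriv f z \<noteq> 0" and "z \<noteq> 0 \<Longrightarrow> f z \<noteq> 0"
  using bspec[OF ff' z] f by (auto simp: ff'_over_z_def class_A_def split: if_splits)

text \<open>
  With \<open>g\<close> the analytic extension of \<open>f z / z\<close> to the origin, which has no zeros, the quotient is
  \<open>f' / g\<close>; this treats the removable singularity without a case distinction.
\<close>
lemma Q_ST_holomorphic:
  assumes f: "f \<in> class_A" and ff': "\<forall>z\<in>unit_disc. ff'_over_z f z \<noteq> 0"
  shows "Q_ST f holomorphic_on unit_disc"
proof -
  have hol: "f holomorphic_on unit_disc" and f0: "f 0 = 0" "deriv f 0 = 1"
    using f by (auto simp: class_A_def)
  define g where "g z = (if z = 0 then deriv f 0 else (f z - f 0) / (z - 0))" for z
  have "g holomorphic_on unit_disc"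
    unfolding g_def by (rule pole_lemma_open[OF hol]) simp
  moreover have "g z \<noteq> 0" if "z \<in> unit_disc" for z
    using class_A_nonvanishing[OF f ff' that] f0 by (auto simp: g_def)
  moreover have "deriv f holomorphic_on unit_disc"
    using hol by (intro holomorphic_deriv) auto
  ultimately have "(\<lambda>z. deriv f z / g z) holomorphic_on unit_disc"
    by (intro holomorphic_on_divide) auto
  also have "(\<lambda>z. deriv f z / g z) = Q_ST f"
    by (auto simp: Q_ST_def g_def f0 fun_eq_iff)
  finally show ?thesis .
qed

text \<open>This is the logarithmic derivative of \<open>z f' = Q_ST f \<cdot> f\<close>, multiplied by \<open>z\<close>.\<close>
lemma Q_CV_eq_Q_ST:
  assumes f: "f \<in> class_A" and ff': "\<forall>z\<in>unit_disc. ff'_over_z f z \<noteq> 0"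
    and z: "z \<in> unit_disc" "z \<noteq> 0"
  shows "Q_CV f z = Q_ST f z + z * deriv (Q_ST f) z / Q_ST f z"
proof -
  note nz = class_A_nonvanishing[OF f ff']
  have hol: "f holomorphic_on unit_disc" using f by (auto simp: class_A_def)
  have d1: "(f has_field_derivative deriv f z) (at z)"
    using z by (intro holomorphic_derivI[OF hol]) auto
  have d2: "(deriv f has_field_derivative deriv (deriv f) z) (at z)"
    using z holomorphic_deriv[OF hol] by (intro holomorphic_derivI[of _ unit_disc]) auto
  have "((\<lambda>w. w * deriv f w / f w) has_field_derivative
     ((deriv f z + z * deriv (deriv f) z) * f z - z * deriv f z * deriv f z) / (f z * f z)) (at z)"
    by (rule derivative_eq_intros d1 d2 nz[OF z(1)] z refl)+ simp
  then have "(Q_ST f has_field_derivative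
     ((deriv f z + z * deriv (deriv f) z) * f z - z * deriv f z * deriv f z) / (f z * f z)) (at z)"
    by (rule has_field_derivative_transform_within_open[of _ _ _ "unit_disc - {0}"])
      (use z in \<open>auto simp: Q_ST_def\<close>)
  then have "deriv (Q_ST f) z =
     ((deriv f z + z * deriv (deriv f) z) * f z - z * deriv f z * deriv f z) / (f z * f z)"
    by (rule DERIV_imp_deriv)
  then show ?thesis
    using nz[OF z(1)] z by (simp add: Q_ST_def Q_CV_def field_simps)
qed

text \<open>
  Since \<open>f'' / f' = (Q_CV - 1) / z\<close>, the Schwarzian quotient is \<open>z Q_CV' + (1 - Q_CV\<^sup>2) / 2\<close>, and
  \<open>z Q_CV'\<close> comes from differentiating \<open>Q_CV = Q_ST + z Q_ST' / Q_ST\<close>.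
\<close>
lemma Q_SD_eq_Q_ST:
  assumes f: "f \<in> class_A" and ff': "\<forall>z\<in>unit_disc. ff'_over_z f z \<noteq> 0"
    and z: "z \<in> unit_disc" "z \<noteq> 0"
  defines "P \<equiv> Q_ST f z" and "a \<equiv> z * deriv (Q_ST f) z"
  shows "Q_SD f z = a + (a + z\<^sup>2 * deriv (deriv (Q_ST f)) z) / P - (a / P)\<^sup>2
           + (1 - (Q_CV f z)\<^sup>2) / 2"
proof -
  note nz = class_A_nonvanishing[OF f ff']
  have hol: "f holomorphic_on unit_disc" using f by (auto simp: class_A_def)
  have holp: "Q_ST f holomorphic_on unit_disc" by (rule Q_ST_holomorphic[OF f ff'])
  have P0: "P \<noteq> 0" using nz[OF z(1)] z by (simp add: P_def Q_ST_def)
  define k where "k w = deriv (deriv f) w / deriv f w" for w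
  have "k holomorphic_on unit_disc"
    unfolding k_def using nz(1) hol by (intro holomorphic_intros holomorphic_deriv) auto
  then have k: "(k has_field_derivative deriv k z) (at z)"
    using z by (intro holomorphic_derivI) auto
  have p: "(Q_ST f has_field_derivative deriv (Q_ST f) z) (at z)"
    using z by (intro holomorphic_derivI[OF holp]) auto
  have p': "(deriv (Q_ST f) has_field_derivative deriv (deriv (Q_ST f)) z) (at z)"
    using z holomorphic_deriv[OF holp] by (intro holomorphic_derivI[of _ unit_disc]) auto
  have "((\<lambda>w. 1 + w * k w) has_field_derivative k z + z * deriv k z) (at z)"
    by (rule derivative_eq_intros k refl)+ simp
  then have "(Q_CV f has_field_derivative k z + z * deriv k z) (at z)"
    by (simp add: Q_CV_def[abs_def] k_def)
  moreover have "((\<lambda>w. Q_ST f w + w * deriv (Q_ST f) w / Q_ST f w) has_field_derivative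
      deriv (Q_ST f) z + ((deriv (Q_ST f) z + z * deriv (deriv (Q_ST f)) z) * P
        - z * deriv (Q_ST f) z * deriv (Q_ST f) z) / (P * P)) (at z)"
    unfolding P_def by (rule derivative_eq_intros p p' refl P0[unfolded P_def])+ simp
  then have "(Q_CV f has_field_derivative
      deriv (Q_ST f) z + ((deriv (Q_ST f) z + z * deriv (deriv (Q_ST f)) z) * P
        - z * deriv (Q_ST f) z * deriv (Q_ST f) z) / (P * P)) (at z)"
    by (rule has_field_derivative_transform_within_open[of _ _ _ "unit_disc - {0}"])
      (use z Q_CV_eq_Q_ST[OF f ff'] in auto)
  ultimately have eq: "k z + z * deriv k z = 
      deriv (Q_ST f) z + ((deriv (Q_ST f) z + z * deriv (deriv (Q_ST f)) z) * P
        - z * deriv (Q_ST f) z * deriv (Q_ST f) z) / (P * P)"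
    by (rule DERIV_unique)
  have "z * (k z + z * deriv k z) = a + (a + z\<^sup>2 * deriv (deriv (Q_ST f)) z) / P - (a / P)\<^sup>2"
    unfolding eq a_def using P0 by (simp add: field_simps power2_eq_square)
  moreover have "Q_SD f z = z * (k z + z * deriv k z) + (1 - (Q_CV f z)\<^sup>2) / 2"
  proof -
    have "Q_SD f z = z\<^sup>2 * (deriv k z - 1 / 2 * (k z)\<^sup>2)"
      by (simp add: Q_SD_def schwarzian_def k_def[abs_def])
    moreover have "Q_CV f z = 1 + z * k z"
      by (simp add: Q_CV_def k_def)
    ultimately show ?thesis
      by (simp add: field_simps power2_eq_square)
  qed
  ultimately show ?thesis by simp
qed

section \<open>Starlikeness\<close>

text \<open>
  All that the four hypotheses need to know about a failure of starlikeness: two imaginary values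
  whose product is bounded away from zero, and the sign of \<open>Im Q_SD\<close> relative to both of them.
\<close>
lemma imaginary_quotients_at_first_zero:
  assumes f: "f \<in> class_A" and ff': "\<forall>z\<in>unit_disc. ff'_over_z f z \<noteq> 0"
    and not: "\<not> starlike_function f"
  obtains z \<rho> \<tau> where "z \<in> unit_disc" "Q_ST f z = \<i> * of_real \<rho>" "Q_CV f z = \<i> * of_real \<tau>"
    "\<rho> * \<tau> \<ge> 1 / 2" "\<rho> * Im (Q_SD f z) \<ge> 0" "\<tau> * Im (Q_SD f z) \<ge> 0"
proof -
  define p where "p = Q_ST f"
  have hol: "p holomorphic_on unit_disc" unfolding p_def by (rule Q_ST_holomorphic[OF f ff'])
  have p0: "p 0 = 1" by (simp add: p_def Q_ST_def)
  obtain z1 where "norm z1 < 1" "Re (p z1) \<le> 0"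
    using f not by (auto simp: starlike_function_def p_def not_less)
  then obtain z where z: "norm z < 1" "z \<noteq> 0" "Re (p z) = 0"
    and pos: "\<And>w. norm w < norm z \<Longrightarrow> Re (p w) > 0"
    and nonneg: "\<And>w. norm w \<le> norm z \<Longrightarrow> Re (p w) \<ge> 0"
    using first_zero_of_real_part[OF hol p0] by blast
  have zd: "z \<in> unit_disc" using z by simp
  define \<rho> where "\<rho> = Im (p z)"
  have p_eq: "p z = \<i> * of_real \<rho>" using z by (simp add: complex_eq_iff \<rho>_def)
  have "p z \<noteq> 0"
    using class_A_nonvanishing[OF f ff' zd] z by (simp add: p_def Q_ST_def)
  then have \<rho>0: "\<rho> \<noteq> 0" using p_eq by auto
  define s where "s = Re (z * deriv p z)"
  define m where "m = z\<^sup>2 * deriv (deriv p) z"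
  have "Re (p z) \<le> Re (p w)" if "norm w = norm z" for w
    using nonneg[of w] that z by simp
  note tang = tangential_derivatives_at_circle_min[OF hol z(1) this]
  have a_eq: "z * deriv p z = of_real s" using tang(1) by (simp add: complex_eq_iff s_def)
  have s: "s \<le> - 1 / 2"
    unfolding s_def by (rule radial_derivative_at_first_zero[OF hol z(1,2) p0 pos z(3)])
  have sm: "s + Re m \<le> 0" using tang(2) by (simp add: a_eq m_def)
  define \<tau> where "\<tau> = \<rho> - s / \<rho>"
  have Q: "Q_CV f z = \<i> * of_real \<tau>"
    using Q_CV_eq_Q_ST[OF f ff' zd z(2)] \<rho>0
    by (simp add: p_def[symmetric] p_eq a_eq \<tau>_def complex_eq_iff field_simps Re_divide Im_divide power2_eq_square)
  have "\<rho> * \<tau> = \<rho>\<^sup>2 - s" using \<rho>0 by (simp add: \<tau>_def field_simps power2_eq_square)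
  then have \<rho>\<tau>: "\<rho> * \<tau> \<ge> 1 / 2" using s by (smt (verit) zero_le_power2 field_sum_of_halves)
  have SD: "Q_SD f z = of_real s + (of_real s + m) / (\<i> * of_real \<rho>) - (of_real s / (\<i> * of_real \<rho>))\<^sup>2
      + (1 - (\<i> * of_real \<tau>)\<^sup>2) / 2"
    using Q_SD_eq_Q_ST[OF f ff' zd z(2)] by (simp add: p_def[symmetric] p_eq a_eq m_def Q)
  have Im_SD: "Im (Q_SD f z) = - (s + Re m) / \<rho>"
    unfolding SD using \<rho>0
    by (simp add: Im_divide Re_divide power2_eq_square field_simps)
  have \<rho>SD: "\<rho> * Im (Q_SD f z) \<ge> 0" using \<rho>0 sm by (simp add: Im_SD)
  have "\<tau> * Im (Q_SD f z) = (\<rho> * \<tau>) * (\<rho> * Im (Q_SD f z)) / \<rho>\<^sup>2"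
    using \<rho>0 by (simp add: power2_eq_square)
  also have "\<dots> \<ge> 0" using \<rho>\<tau> by (intro divide_nonneg_nonneg mult_nonneg_nonneg[OF _ \<rho>SD]) auto
  finally have "\<tau> * Im (Q_SD f z) \<ge> 0" .
  with \<rho>\<tau> \<rho>SD Q zd show ?thesis using that p_eq by (auto simp: p_def)
qed

text \<open>
  The left-hand side equals \<open>- \<alpha> x y - \<beta> x Im S\<close>, because \<open>(\<i> t)\<^sup>2\<close> is real. Here \<open>x\<close> and \<open>y\<close> are
  \<open>\<rho>\<close> and \<open>\<tau>\<close> in either order, and \<open>t\<close> is whichever of them is squared.
\<close>
lemma Re_imaginary_product_le:
  fixes S :: complex and \<alpha> \<beta> x y t :: real
  assumes "\<alpha> \<ge> 0" "\<beta> \<ge> 0" "x * y \<ge> 1 / 2" "x * Im S \<ge> 0"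
  shows "Re (\<i> * of_real x * (of_real \<alpha> * (\<i> * of_real y)
      + (1 - of_real \<alpha>) * (\<i> * of_real t)\<^sup>2 + of_real \<beta> * S)) \<le> - \<alpha> / 2"
proof -
  have "\<alpha> * (1 / 2) \<le> \<alpha> * (x * y)"
    using assms(1,3) by (intro mult_left_mono)
  moreover have "0 \<le> \<beta> * (x * Im S)"
    using assms(2,4) by (rule mult_nonneg_nonneg)
  ultimately show ?thesis by (simp add: power2_eq_square algebra_simps)
qed

theorem theorem2p3:
  fixes \<alpha> \<beta> :: real and f :: "complex \<Rightarrow> complex"
  assumes "\<alpha> \<ge> 0" and "\<beta> \<ge> 0"
    and "f \<in> class_A"
    and "\<forall>z\<in>unit_disc. ff'_over_z f z \<noteq> 0"
    and "(\<forall>z\<in>unit_disc. Re (Q_CV f z * (of_real \<alpha> * Q_ST f z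
              + (1 - of_real \<alpha>) * (Q_ST f z)\<^sup>2 + of_real \<beta> * Q_SD f z)) > - \<alpha> / 2)
       \<or> (\<forall>z\<in>unit_disc. Re (Q_ST f z * (of_real \<alpha> * Q_CV f z
              + (1 - of_real \<alpha>) * (Q_CV f z)\<^sup>2 + of_real \<beta> * Q_SD f z)) > - \<alpha> / 2)
       \<or> (\<forall>z\<in>unit_disc. Re (Q_ST f z * (of_real \<alpha> * Q_CV f z
              + (1 - of_real \<alpha>) * (Q_ST f z)\<^sup>2 + of_real \<beta> * Q_SD f z)) > - \<alpha> / 2)
       \<or> (\<forall>z\<in>unit_disc. Re (Q_CV f z * (of_real \<alpha> * Q_ST f z
              + (1 - of_real \<alpha>) * (Q_CV f z)\<^sup>2 + of_real \<beta> * Q_SD f z)) > - \<alpha> / 2)"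
  shows "starlike_function f"
proof (rule ccontr)
  assume "\<not> starlike_function f"
  then obtain z \<rho> \<tau> where z: "z \<in> unit_disc"
    and Q: "Q_ST f z = \<i> * of_real \<rho>" "Q_CV f z = \<i> * of_real \<tau>"
    and signs: "\<rho> * \<tau> \<ge> 1 / 2" "\<rho> * Im (Q_SD f z) \<ge> 0" "\<tau> * Im (Q_SD f z) \<ge> 0"
    using imaginary_quotients_at_first_zero assms(3,4) by metis
  have st: "Re (Q_ST f z * (of_real \<alpha> * Q_CV f z + (1 - of_real \<alpha>) * (\<i> * of_real t)\<^sup>2
      + of_real \<beta> * Q_SD f z)) \<le> - \<alpha> / 2" for t
    unfolding Q by (rule Re_imaginary_product_le) (use assms(1,2) signs in auto)
  have cv: "Re (Q_CV f z * (of_real \<alpha> * Q_ST f z + (1 - of_real \<alpha>) * (\<i> * of_real t)\<^sup>2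
      + of_real \<beta> * Q_SD f z)) \<le> - \<alpha> / 2" for t
    unfolding Q by (rule Re_imaginary_product_le) (use assms(1,2) signs in \<open>auto simp: mult.commute\<close>)
  from assms(5) show False
    using st[of \<rho>] st[of \<tau>] cv[of \<rho>] cv[of \<tau>] z unfolding Q[symmetric]
    by (meson not_less)
qed

end
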